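(* Every oriented path with exactly two blocks and at least three arcs is tournament anti-Sidorenko.
   Context: An oriented graph $\vec{H}$ is a pair $(V(\vec{H}),A(\vec{H}))$ with (finite) vertex set $V(\vec H)$ and arc set $A(\vec{H})\subseteq V(\vec{H})\times V(\vec{H})$ containing no self-loops and at most one arc between any pair of distinct vertices. Write $v(\vec H)=|V(\vec H)|$ and $a(\vec H)=|A(\vec H)|$. A tournament is an oriented graph with exactly one arc between every pair of distinct vertices. A homomorphism $f:\vec H\to\vec G$ is a function $f:V(\vec H)\to V(\vec G)$ such that $(f(u),f(v))\in A(\vec G)$ for all $(u,v)\in A(\vec H)$; $\hom(\vec H,\vec G)$ is the number of homomorphisms and $t(\vec H,\vec G)=\hom(\vec H,\vec G)/v(\vec G)^{v(\vec H)}$. An oriented graph $\vec H$ is tournament anti-Sidorenko if $t(\vec H,\vec T)\le (1/2)^{a(\vec H)}$ for every tournament $\vec T$. An oriented path is an oriented graph obtained by choosing a direction for each edge of an undirected path. A block of an oriented path is a maximal subpath in which all arcs are oriented in the same direction (along the path). *)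

theory Defs
  imports Complex_Main "HOL-Library.FuncSet"
    "Graph_Theory.Pair_Digraph" "Graph_Theory.Digraph_Component"
begin

locale oriented_graph = pair_digraph G for G :: "'a pair_pre_digraph" +
  assumes asymmetric: "(u, v) \<in> parcs G \<Longrightarrow> (v, u) \<notin> parcs G"

text \<open>At most one arc between two vertices is already part of \<^locale>\<open>oriented_graph\<close>.\<close>

locale tournament = oriented_graph G for G :: "'a pair_pre_digraph" +
  assumes total: "u \<in> pverts G \<Longrightarrow> v \<in> pverts G \<Longrightarrow> u \<noteq> v
    \<Longrightarrow> (u, v) \<in> parcs G \<or> (v, u) \<in> parcs G"

text \<open>Homomorphisms are extensional functions on the vertex set, so that counting them
  does not depend on values outside it.\<close>

definition homs :: "'a pair_pre_digraph \<Rightarrow> 'b pair_pre_digraph \<Rightarrow> ('a \<Rightarrow> 'b) set" where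
  "homs H G = {f \<in> pverts H \<rightarrow>\<^sub>E pverts G. \<forall>(u, v) \<in> parcs H. (f u, f v) \<in> parcs G}"

definition hom_density :: "'a pair_pre_digraph \<Rightarrow> 'b pair_pre_digraph \<Rightarrow> real" where
  "hom_density H G = real (card (homs H G)) / real (card (pverts G)) ^ card (pverts H)"

text \<open>A definition cannot quantify over types, so the type from which the vertices of the
  tournaments are taken is a parameter.\<close>

definition tournament_anti_sidorenko ::
    "'b itself \<Rightarrow> 'a pair_pre_digraph \<Rightarrow> bool" where
  "tournament_anti_sidorenko TYPE('b) H \<longleftrightarrow>
    (\<forall>T :: 'b pair_pre_digraph. tournament T \<longrightarrow> hom_density H T \<le> (1/2) ^ card (parcs H))"

text \<open>The list enumerates the vertices of the underlying undirected path from one end to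
  the other; both enumerations of a path qualify.\<close>

definition path_order :: "'a list \<Rightarrow> 'a pair_pre_digraph \<Rightarrow> bool" where
  "path_order p H \<longleftrightarrow> p \<noteq> [] \<and> distinct p \<and> pverts H = set p \<and>
    (\<forall>u v. (u, v) \<in> parcs H \<or> (v, u) \<in> parcs H \<longleftrightarrow>
      (\<exists>i. Suc i < length p \<and> {u, v} = {p ! i, p ! Suc i}))"

definition oriented_path :: "'a pair_pre_digraph \<Rightarrow> bool" where
  "oriented_path H \<longleftrightarrow> oriented_graph H \<and> (\<exists>p. path_order p H)"

definition unidirectional_path :: "'a pair_pre_digraph \<Rightarrow> bool" where
  "unidirectional_path H \<longleftrightarrow> oriented_graph H \<and> (\<exists>p. path_order p H \<and>
    ((\<forall>i. Suc i < length p \<longrightarrow> (p ! i, p ! Suc i) \<in> parcs H) \<or>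
     (\<forall>i. Suc i < length p \<longrightarrow> (p ! Suc i, p ! i) \<in> parcs H)))"

text \<open>Subpaths are those subgraphs that are themselves paths. A single vertex is one of them,
  but is never maximal in a path that has an arc.\<close>

definition blocks :: "'a pair_pre_digraph \<Rightarrow> 'a pair_pre_digraph set" where
  "blocks H = {B. subgraph (with_proj B) (with_proj H) \<and> unidirectional_path B \<and>
    (\<forall>B'. subgraph (with_proj B') (with_proj H) \<and> unidirectional_path B' \<and>
      subgraph (with_proj B) (with_proj B') \<longrightarrow> B' = B)}"

end

theory Submission
  imports Defs "HOL-Analysis.Convex"
begin

text \<open>
  Let \<open>K x y\<close> be \<open>1\<close>, \<open>- 1\<close> or \<open>0\<close> according to whether a tournament on \<open>n\<close> vertices contains
  \<open>(x, y)\<close>, contains \<open>(y, x)\<close>, or has \<open>x = y\<close>. The adjacency matrix is entrywise at most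
  \<open>(1 + K x y) / 2\<close>, so with \<open>B f = avg f + K f / n\<close> and the averaged inner product \<open>ip\<close>, the
  density of a path that consists of two directed paths of lengths \<open>k\<close> and \<open>l\<close> leaving
  a common vertex is at most \<open>ip (B^k 1) (B^l 1) / 2^(k + l)\<close>. It remains to see that
  the inner product is at most \<open>1\<close> unless \<open>k = l = 1\<close> (\<open>ip_walk_walk_le\<close>).

  This is linear algebra for a skew matrix \<open>K\<close> with entries in \<open>[-1, 1]\<close>; passing from \<open>K\<close> to \<open>- K\<close>
  exchanges the two ways in which the directed paths can meet. Let \<open>u\<close> be the vector of row means of
  \<open>K\<close> and \<open>\<mu> = ip u u\<close>. Then \<open>ip (B 1) (B 1) = 1 + \<mu>\<close>, so the norm grows in the first step, and
  no argument from one step to the next can use the norm alone. The quantity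
  \<open>ip f f - 2 * avg f * ip u f\<close>, called the potential of \<open>f\<close>, however never grows under \<open>B\<close>
  (\<open>potential_step_le\<close>). What makes this work is an operator norm bound: the mean square of the
  entries of \<open>K\<close> is at most \<open>1\<close>, the interaction of \<open>K\<close> with the constants uses up \<open>2 * \<mu>\<close> of it, and
  the singular values of a skew matrix come in equal pairs, so the compression of \<open>K\<close> to the
  functions of mean \<open>0\<close> has squared norm at most \<open>1/2 - \<mu>\<close> (\<open>compress_norm_le\<close>).

  After two steps the potential is at most \<open>1 - 5/2 * \<mu> + 2 * \<mu>^2\<close>, and it stays below that value.
  Each of the two inequalities \<open>norm_step_le\<close> and \<open>avg_plus_ip_row_mean_step_le\<close> loses a factor
  that this gain pays for. The first gives that \<open>B^k 1\<close> has norm at most \<open>1\<close> for \<open>k \<ge> 2\<close>, which by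
  the Cauchy-Schwarz inequality settles blocks with at least two arcs; the second treats the
  inner product of \<open>B 1\<close> with \<open>B^k 1\<close>, that is, a block with a single arc.

  Finally, a path has exactly two blocks only if its direction changes exactly once
  (\<open>two_blocks_turning_point\<close>): without a change the path is its own only block, and arcs
  \<open>i < j < k\<close> of alternating directions lie in three different blocks.
\<close>


section \<open>Averages over a finite set\<close>

text \<open>
  The arithmetic-geometric mean inequality in the form in which it turns a Cauchy-Schwarz bound
  into a linear one.
\<close>

lemma two_mult_le_add_of_sq_le_mult:
  fixes x s t :: real
  assumes "x\<^sup>2 \<le> s * t" "s \<ge> 0" "t \<ge> 0"
  shows "2 * x \<le> s + t"
proof -
  have "(2 * x)\<^sup>2 \<le> 4 * (s * t)" using assms(1) by (simp add: power_mult_distrib)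
  also have "\<dots> = (s + t)\<^sup>2 - (s - t)\<^sup>2" by (simp add: power2_eq_square algebra_simps)
  also have "\<dots> \<le> (s + t)\<^sup>2" by simp
  finally show ?thesis using assms(2,3) by (intro power2_le_imp_le[of "2 * x"]) auto
qed

locale finite_average =
  fixes V :: "'v set"
  assumes finite_V: "finite V" and nonempty_V: "V \<noteq> {}"
begin

definition avg :: "('v \<Rightarrow> real) \<Rightarrow> real" where
  "avg f = (\<Sum>x\<in>V. f x) / real (card V)"

definition ip :: "('v \<Rightarrow> real) \<Rightarrow> ('v \<Rightarrow> real) \<Rightarrow> real" where
  "ip f g = avg (\<lambda>x. f x * g x)"

lemma card_V_pos: "real (card V) > 0"
  using finite_V nonempty_V by (simp add: card_gt_0_iff)

lemma avg_add: "avg (\<lambda>x. f x + g x) = avg f + avg g"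
  and avg_diff: "avg (\<lambda>x. f x - g x) = avg f - avg g"
  and avg_minus: "avg (\<lambda>x. - f x) = - avg f"
  and avg_mult_left: "avg (\<lambda>x. c * f x) = c * avg f"
  and avg_mult_right: "avg (\<lambda>x. f x * c) = avg f * c"
  by (simp_all add: avg_def sum.distrib sum_subtractf sum_negf add_divide_distrib
      diff_divide_distrib sum_distrib_left sum_distrib_right)

lemma avg_const: "avg (\<lambda>x. c) = c"
  using card_V_pos by (simp add: avg_def)

lemma avg_mono: "(\<And>x. x \<in> V \<Longrightarrow> f x \<le> g x) \<Longrightarrow> avg f \<le> avg g"
  using card_V_pos by (simp add: avg_def divide_right_mono sum_mono)

lemma avg_cong: "(\<And>x. x \<in> V \<Longrightarrow> f x = g x) \<Longrightarrow> avg f = avg g"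
  by (simp add: avg_def)

lemma avg_swap: "avg (\<lambda>x. avg (\<lambda>y. f x y)) = avg (\<lambda>y. avg (\<lambda>x. f x y))"
  unfolding avg_def sum_divide_distrib[symmetric] by (subst sum.swap) (rule refl)

lemmas avg_simps = avg_add avg_diff avg_minus avg_mult_left avg_mult_right avg_const

lemma ip_commute: "ip f g = ip g f"
  by (simp add: ip_def mult.commute)

lemma ip_simps:
  "ip (\<lambda>x. f x + g x) h = ip f h + ip g h"
  "ip (\<lambda>x. f x - g x) h = ip f h - ip g h"
  "ip (\<lambda>x. - f x) h = - ip f h"
  "ip (\<lambda>x. c * f x) h = c * ip f h"
  "ip (\<lambda>x. c) h = c * avg h"
  "ip h (\<lambda>x. f x + g x) = ip h f + ip h g"
  "ip h (\<lambda>x. f x - g x) = ip h f - ip h g"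
  "ip h (\<lambda>x. - f x) = - ip h f"
  "ip h (\<lambda>x. c * f x) = c * ip h f"
  "ip h (\<lambda>x. c) = c * avg h"
  by (simp_all add: ip_def ring_distribs avg_simps mult.left_commute mult.assoc)

lemma ip_nonneg: "ip f f \<ge> 0"
  by (simp add: ip_def avg_def sum_nonneg divide_nonneg_nonneg)

lemma Cauchy_Schwarz_ip: "(ip f g)\<^sup>2 \<le> ip f f * ip g g"
proof -
  have "(\<Sum>x\<in>V. f x * g x)\<^sup>2 \<le> (\<Sum>x\<in>V. (f x)\<^sup>2) * (\<Sum>x\<in>V. (g x)\<^sup>2)"
    by (rule Cauchy_Schwarz_ineq_sum)
  then show ?thesis
    by (simp add: ip_def avg_def power_divide power2_eq_square divide_right_mono)
qed

lemma Cauchy_Schwarz_avg_avg: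
  "(avg (\<lambda>x. avg (\<lambda>y. F x y * G x y)))\<^sup>2
    \<le> avg (\<lambda>x. avg (\<lambda>y. (F x y)\<^sup>2)) * avg (\<lambda>x. avg (\<lambda>y. (G x y)\<^sup>2))"
proof -
  have avg_avg: "avg (\<lambda>x. avg (\<lambda>y. h x y)) = (\<Sum>p\<in>V \<times> V. h (fst p) (snd p)) / (real (card V))\<^sup>2"
    for h :: "'v \<Rightarrow> 'v \<Rightarrow> real"
    by (simp add: avg_def sum_divide_distrib[symmetric] power2_eq_square
        sum.cartesian_product case_prod_beta)
  have "(\<Sum>p\<in>V \<times> V. F (fst p) (snd p) * G (fst p) (snd p))\<^sup>2
      \<le> (\<Sum>p\<in>V \<times> V. (F (fst p) (snd p))\<^sup>2) * (\<Sum>p\<in>V \<times> V. (G (fst p) (snd p))\<^sup>2)"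
    by (rule Cauchy_Schwarz_ineq_sum)
  then show ?thesis
    unfolding avg_avg power_divide times_divide_times_eq
    by (simp add: power2_eq_square divide_right_mono)
qed

definition kernel_op :: "('v \<Rightarrow> 'v \<Rightarrow> real) \<Rightarrow> ('v \<Rightarrow> real) \<Rightarrow> 'v \<Rightarrow> real" where
  "kernel_op k f = (\<lambda>x. avg (\<lambda>y. k x y * f y))"

lemma ip_kernel_op_skew:
  fixes k :: "'v \<Rightarrow> 'v \<Rightarrow> real"
  assumes "\<And>x y. x \<in> V \<Longrightarrow> y \<in> V \<Longrightarrow> k y x = - k x y"
  shows "ip f (kernel_op k g) = - ip (kernel_op k f) g"
proof -
  have "ip f (kernel_op k g) = avg (\<lambda>y. avg (\<lambda>x. f x * (k x y * g y)))"
    unfolding ip_def kernel_op_def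
    by (subst avg_swap) (simp add: avg_mult_left)
  also have "\<dots> = avg (\<lambda>y. avg (\<lambda>x. - (k y x * f x * g y)))"
    by (intro avg_cong) (subst assms; simp add: mult_ac)
  also have "\<dots> = - ip (kernel_op k f) g"
    by (simp add: ip_def kernel_op_def avg_simps)
  finally show ?thesis .
qed

text \<open>
  The operator norm of any kernel is at most its Hilbert-Schmidt norm; the factor \<open>2\<close> is gained
  because the singular values of a skew kernel come in pairs. Concretely, with \<open>w = k f\<close>, the
  kernel \<open>k\<close> is tested against the skew kernel \<open>w x * f y - f x * w y\<close>, which gives
  \<open>2 * ip w w\<close>, while the mean square of the latter is at most \<open>2 * ip w w * ip f f\<close>.
\<close>

lemma skew_kernel_op_norm_le:
  fixes k :: "'v \<Rightarrow> 'v \<Rightarrow> real"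
  assumes skew: "\<And>x y. x \<in> V \<Longrightarrow> y \<in> V \<Longrightarrow> k y x = - k x y"
  shows "2 * ip (kernel_op k f) (kernel_op k f) \<le> avg (\<lambda>x. avg (\<lambda>y. (k x y)\<^sup>2)) * ip f f"
proof -
  define w where "w = kernel_op k f"
  define H where "H = avg (\<lambda>x. avg (\<lambda>y. (k x y)\<^sup>2))"
  have H: "H \<ge> 0"
    unfolding H_def by (simp add: avg_def sum_nonneg)
  have "ip w w = avg (\<lambda>x. avg (\<lambda>y. k x y * (w x * f y)))"
    by (subst (2) w_def) (simp add: ip_def kernel_op_def avg_mult_left[symmetric] mult_ac)
  moreover have "ip f (kernel_op k w) = avg (\<lambda>x. avg (\<lambda>y. k x y * (f x * w y)))"
    by (simp add: ip_def kernel_op_def avg_mult_left[symmetric] mult_ac)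
  moreover have "ip f (kernel_op k w) = - ip w w"
    using ip_kernel_op_skew[OF skew, where f = f and g = w] by (simp add: w_def)
  ultimately have "2 * ip w w = avg (\<lambda>x. avg (\<lambda>y. k x y * (w x * f y - f x * w y)))"
    by (simp add: right_diff_distrib avg_diff)
  then have "(2 * ip w w)\<^sup>2 \<le> H * avg (\<lambda>x. avg (\<lambda>y. (w x * f y - f x * w y)\<^sup>2))"
    by (simp only: H_def Cauchy_Schwarz_avg_avg)
  also have "avg (\<lambda>x. avg (\<lambda>y. (w x * f y - f x * w y)\<^sup>2)) = 2 * (ip w w * ip f f) - 2 * (ip w f)\<^sup>2"
  proof -
    have "avg (\<lambda>x. avg (\<lambda>y. (w x * f y - f x * w y)\<^sup>2))
       = avg (\<lambda>x. avg (\<lambda>y. (w x * w x) * (f y * f y) + (f x * f x) * (w y * w y)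
            - (2 * (w x * f x)) * (w y * f y)))"
      by (simp add: power2_eq_square algebra_simps)
    then show ?thesis
      by (simp only: avg_simps flip: ip_def) (simp add: power2_eq_square)
  qed
  also have "H * \<dots> \<le> H * (2 * (ip w w * ip f f))"
    using H by (intro mult_left_mono) auto
  finally have "(2 * ip w w) * (2 * ip w w) \<le> (H * ip f f) * (2 * ip w w)"
    by (simp add: power2_eq_square mult_ac)
  then have "2 * ip w w \<le> H * ip f f"
  proof (cases "ip w w = 0")
    case True
    then show ?thesis using H ip_nonneg[of f] by simp
  next
    case False
    then have "2 * ip w w > 0" using ip_nonneg[of w] by simp
    with \<open>(2 * ip w w) * (2 * ip w w) \<le> _\<close> show ?thesis
      by (rule mult_right_le_imp_le)
  qed
  then show ?thesis by (simp only: w_def H_def)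
qed

end

section \<open>Iterating a rank-one plus skew operator\<close>

locale skew_kernel = finite_average V for V :: "'v set" +
  fixes K :: "'v \<Rightarrow> 'v \<Rightarrow> real"
  assumes skew: "\<And>x y. x \<in> V \<Longrightarrow> y \<in> V \<Longrightarrow> K y x = - K x y"
    and abs_le_1: "\<And>x y. x \<in> V \<Longrightarrow> y \<in> V \<Longrightarrow> \<bar>K x y\<bar> \<le> 1"
begin

definition row_mean :: "'v \<Rightarrow> real" where "row_mean = (\<lambda>x. avg (K x))"

definition \<mu> :: real where "\<mu> = ip row_mean row_mean"

text \<open>
  The operator \<open>B\<close>: the averaged kernel operator of \<open>1 + K x y\<close>.
\<close>

definition step :: "('v \<Rightarrow> real) \<Rightarrow> 'v \<Rightarrow> real" where
  "step f = (\<lambda>x. avg f + kernel_op K f x)"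

lemma ip_kernel_op: "ip f (kernel_op K g) = - ip (kernel_op K f) g"
  by (rule ip_kernel_op_skew) (rule skew)

lemma avg_K: "avg (K x) = row_mean x"
  by (simp add: row_mean_def)

lemma avg_kernel_op: "avg (kernel_op K f) = - ip row_mean f"
  using ip_kernel_op[of "\<lambda>x. 1" f] by (simp add: ip_def row_mean_def kernel_op_def)

lemma ip_kernel_op_self: "ip f (kernel_op K f) = 0"
  using ip_kernel_op[of f f] by (simp add: ip_commute)

lemma avg_row_mean: "avg row_mean = 0"
  using ip_kernel_op_self[of "\<lambda>x. 1"] by (simp add: ip_def row_mean_def kernel_op_def)

text \<open>
  Subtracting \<open>row_mean x - row_mean y\<close> removes from \<open>K\<close> its interaction with the constant
  functions. This is an orthogonal projection, and the removed part has mean square \<open>2 * \<mu>\<close>: it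
  consists of one row and one column, in a basis that starts with the constant function.
\<close>

lemma deflated_energy: "avg (\<lambda>x. avg (\<lambda>y. (K x y - row_mean x + row_mean y)\<^sup>2)) \<le> 1 - 2 * \<mu>"
proof -
  have col: "avg (\<lambda>x. K x y) = - row_mean y" if "y \<in> V" for y
  proof -
    have "avg (\<lambda>x. K x y) = avg (\<lambda>x. - K y x)"
      using that by (intro avg_cong skew)
    then show ?thesis by (simp add: avg_minus row_mean_def)
  qed
  have "avg (\<lambda>x. avg (\<lambda>y. (K x y - row_mean x + row_mean y)\<^sup>2)) =
      avg (\<lambda>x. avg (\<lambda>y. (K x y)\<^sup>2 + row_mean x * row_mean x + row_mean y * row_mean y
         - (2 * row_mean x) * K x y - (2 * row_mean x) * row_mean y + 2 * (K x y * row_mean y)))"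
    by (simp add: power2_eq_square algebra_simps)
  also have "\<dots> = avg (\<lambda>x. avg (\<lambda>y. (K x y)\<^sup>2)) + \<mu> + \<mu> - 2 * \<mu>
      + 2 * avg (\<lambda>x. avg (\<lambda>y. K x y * row_mean y))"
    by (simp add: avg_simps avg_row_mean mult.assoc avg_K \<mu>_def ip_def)
  also have "avg (\<lambda>x. avg (\<lambda>y. K x y * row_mean y)) = avg (\<lambda>y. - row_mean y * row_mean y)"
    by (subst avg_swap, intro avg_cong) (simp add: avg_mult_right col)
  also have "\<dots> = - \<mu>" by (simp add: avg_minus \<mu>_def ip_def)
  finally have "avg (\<lambda>x. avg (\<lambda>y. (K x y - row_mean x + row_mean y)\<^sup>2)) = avg (\<lambda>x. avg (\<lambda>y. (K x y)\<^sup>2)) - 2 * \<mu>"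
    by simp
  moreover have "avg (\<lambda>x. avg (\<lambda>y. (K x y)\<^sup>2)) \<le> avg (\<lambda>x. avg (\<lambda>y. 1))"
    by (intro avg_mono) (simp add: abs_le_1 abs_square_le_1)
  ultimately show ?thesis by (simp add: avg_const)
qed

lemma mu_nonneg: "\<mu> \<ge> 0" by (simp add: \<mu>_def ip_nonneg)

lemma mu_le_half: "\<mu> \<le> 1 / 2"
proof -
  have "0 \<le> avg (\<lambda>x. avg (\<lambda>y. (K x y - row_mean x + row_mean y)\<^sup>2))"
    by (simp add: avg_def sum_nonneg)
  with deflated_energy show ?thesis by linarith
qed

text \<open>
  The operator \<open>K\<close> compressed to the functions of mean \<open>0\<close> and extended by \<open>0\<close> to constants; it
  is the operator of the kernel in \<open>deflated_energy\<close>.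
\<close>

definition compress :: "('v \<Rightarrow> real) \<Rightarrow> 'v \<Rightarrow> real" where
  "compress f = (\<lambda>x. kernel_op K f x - avg f * row_mean x + ip row_mean f)"

lemma compress_norm_le:
  "2 * ip (compress f) (compress f) \<le> (1 - 2 * \<mu>) * ip f f"
proof -
  have "compress f = kernel_op (\<lambda>x y. K x y - row_mean x + row_mean y) f"
    by (auto simp: compress_def kernel_op_def ip_def ring_distribs avg_simps)
  moreover have "2 * ip (kernel_op (\<lambda>x y. K x y - row_mean x + row_mean y) f)
        (kernel_op (\<lambda>x y. K x y - row_mean x + row_mean y) f)
      \<le> avg (\<lambda>x. avg (\<lambda>y. (K x y - row_mean x + row_mean y)\<^sup>2)) * ip f f"
    by (rule skew_kernel_op_norm_le) (subst skew; simp)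
  moreover have "\<dots> \<le> (1 - 2 * \<mu>) * ip f f"
    by (intro mult_right_mono deflated_energy ip_nonneg)
  ultimately show ?thesis by simp
qed

lemma ip_compress: "ip f (compress g) = - ip (compress f) g"
  using ip_kernel_op[of f g]
  by (simp add: compress_def ip_simps ip_commute[of f row_mean] mult.commute)

text \<open>
  Write \<open>a = avg f\<close> and \<open>d = ip row_mean f\<close>. One step changes \<open>ip f f\<close> by terms of first order in
  \<open>row_mean\<close>, which have no sign, and at a constant function by \<open>a^2 * \<mu>\<close>, which is positive. The
  change of \<open>a * d\<close> contains the same terms with half the coefficient, except that it contains
  \<open>a^2 * \<mu>\<close> fully. Subtracting \<open>2 * a * d\<close> therefore cancels the terms without a sign and leaves
  \<open>- a^2 * \<mu>\<close> as the leading term.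
\<close>

definition potential :: "('v \<Rightarrow> real) \<Rightarrow> real" where
  "potential f = ip f f - 2 * avg f * ip row_mean f"

lemma compress_const: "compress (\<lambda>x. c) = (\<lambda>x. 0)"
  by (simp add: compress_def kernel_op_def avg_simps row_mean_def ip_simps avg_row_mean[unfolded row_mean_def])

lemma compress_diff: "compress (\<lambda>x. f x - g x) = (\<lambda>x. compress f x - compress g x)"
  by (simp add: compress_def kernel_op_def ip_simps avg_simps algebra_simps)

lemma avg_compress: "avg (compress f) = 0"
  by (simp add: compress_def avg_simps avg_kernel_op avg_row_mean)

lemma ip_compress_self: "ip f (compress f) = 0"
  using ip_compress[of f f] by (simp add: ip_commute)

text \<open>
  The component of \<open>step f\<close> along the constants followed by the component of mean \<open>0\<close>. All
  quadratic quantities of \<open>step f\<close> are read off from this splitting.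
\<close>

lemma step_decomp: "step f = (\<lambda>x. (avg f - ip row_mean f) + avg f * row_mean x + compress f x)"
  by (auto simp: step_def compress_def)

lemma avg_step: "avg (step f) = avg f - ip row_mean f"
  by (simp add: step_def avg_simps avg_kernel_op)

lemma ip_row_mean_step: "ip row_mean (step f) = avg f * \<mu> + ip row_mean (compress f)"
  by (simp add: step_decomp ip_simps avg_simps avg_row_mean \<mu>_def)

lemma ip_step_step:
  "ip (step f) (step f) = (avg f - ip row_mean f)\<^sup>2 + (avg f)\<^sup>2 * \<mu> + 2 * avg f * ip row_mean (compress f)
     + ip (compress f) (compress f)"
  by (simp add: step_decomp ip_simps avg_simps avg_row_mean avg_compress ip_commute[of "compress f" row_mean]
      \<mu>_def power2_eq_square algebra_simps)

definition dev_sq :: "('v \<Rightarrow> real) \<Rightarrow> real" where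
  "dev_sq f = ip f f - (avg f)\<^sup>2"

lemma dev_sq_eq: "dev_sq f = ip (\<lambda>x. f x - avg f) (\<lambda>x. f x - avg f)"
  by (simp add: dev_sq_def ip_simps avg_simps power2_eq_square)

lemma dev_sq_nonneg: "dev_sq f \<ge> 0"
  by (simp add: dev_sq_eq ip_nonneg)

lemma ip_row_mean_sq_le: "(ip row_mean f)\<^sup>2 \<le> \<mu> * dev_sq f"
  using Cauchy_Schwarz_ip[of row_mean "\<lambda>x. f x - avg f"]
  by (simp add: ip_simps avg_row_mean \<mu>_def dev_sq_eq)

lemma compress_norm_le_dev:
  "2 * ip (compress f) (compress f) \<le> (1 - 2 * \<mu>) * dev_sq f"
  using compress_norm_le[of "\<lambda>x. f x - avg f"]
  by (simp add: compress_diff compress_const dev_sq_eq)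

text \<open>
  Together with \<open>\<mu>\<close>, this number determines the norm and the potential of \<open>B^2 1\<close>.
\<close>

definition \<nu> :: real where "\<nu> = ip (compress row_mean) (compress row_mean)"

lemma nu_nonneg: "\<nu> \<ge> 0" by (simp add: \<nu>_def ip_nonneg)

lemma nu_le: "2 * \<nu> \<le> (1 - 2 * \<mu>) * \<mu>"
  using compress_norm_le[of row_mean] by (simp add: \<nu>_def \<mu>_def)

lemma ip_row_mean_compress_sq_le: "(ip row_mean (compress f))\<^sup>2 \<le> \<mu> * ip (compress f) (compress f)"
  using Cauchy_Schwarz_ip[of row_mean "compress f"] by (simp add: \<mu>_def)

lemma ip_row_mean_compress_sq_le_dev: "(ip row_mean (compress f))\<^sup>2 \<le> \<nu> * dev_sq f"
  using Cauchy_Schwarz_ip[of "compress row_mean" "\<lambda>x. f x - avg f"]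
  by (simp add: ip_simps avg_compress \<nu>_def dev_sq_eq ip_compress[of row_mean f])

lemma potential_eq: "potential f = (avg f)\<^sup>2 + dev_sq f - 2 * avg f * ip row_mean f"
  by (simp add: potential_def dev_sq_def)

lemma potential_step:
  "potential (step f) = potential f + (ip row_mean f)\<^sup>2 - (avg f)\<^sup>2 * \<mu> + 2 * (avg f * ip row_mean f) * \<mu>
      + 2 * (ip row_mean f * ip row_mean (compress f)) + ip (compress f) (compress f) - dev_sq f"
  unfolding potential_def[of "step f"] ip_step_step avg_step ip_row_mean_step potential_eq[of f]
  by algebra

text \<open>
  In \<open>potential_step\<close> the last term \<open>- dev_sq f\<close> has to absorb everything else. The compression
  uses up \<open>1/2 - \<mu>\<close> of it directly and as much again in the mixed term; the remaining terms
  need \<open>\<mu> + 2 * \<mu>^2\<close>, so the total is \<open>1 - \<mu> + 2 * \<mu>^2\<close>, which is at most \<open>1\<close> because \<open>\<mu> \<le> 1/2\<close>.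
\<close>

lemma potential_step_le: "potential (step f) \<le> potential f"
proof -
  define a d y W r where defs: "a = avg f" "d = ip row_mean f" "y = ip row_mean (compress f)"
    "W = ip (compress f) (compress f)" "r = dev_sq f"
  have d: "d\<^sup>2 \<le> \<mu> * r" and y: "y\<^sup>2 \<le> \<mu> * W" and W: "2 * W \<le> (1 - 2 * \<mu>) * r" and "W \<ge> 0" "r \<ge> 0"
    unfolding defs by (rule ip_row_mean_sq_le ip_row_mean_compress_sq_le compress_norm_le_dev ip_nonneg dev_sq_nonneg)+
  have "2 * (a * d) * \<mu> \<le> (a\<^sup>2 + d\<^sup>2) * \<mu>"
    using mu_nonneg sum_squares_bound[of a d] by (intro mult_right_mono) auto
  moreover have "d\<^sup>2 * \<mu> \<le> \<mu> * r * \<mu>"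
    using d mu_nonneg by (intro mult_right_mono) auto
  moreover have "2 * (d * y) \<le> \<mu> * \<mu> * r + W"
  proof (rule two_mult_le_add_of_sq_le_mult)
    have "d\<^sup>2 * y\<^sup>2 \<le> (\<mu> * r) * (\<mu> * W)"
      using d y \<open>r \<ge> 0\<close> mu_nonneg by (intro mult_mono) auto
    then show "(d * y)\<^sup>2 \<le> \<mu> * \<mu> * r * W" by (simp add: power_mult_distrib mult_ac)
  qed (use mu_nonneg \<open>r \<ge> 0\<close> \<open>W \<ge> 0\<close> in auto)
  moreover have "\<mu> * (\<mu> * r) \<le> (1 / 2) * (\<mu> * r)"
    using mu_le_half mu_nonneg \<open>r \<ge> 0\<close> by (intro mult_right_mono) auto
  ultimately have "d\<^sup>2 - a\<^sup>2 * \<mu> + 2 * (a * d) * \<mu> + 2 * (d * y) + W - r \<le> 0"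
    using d W by (simp add: algebra_simps)
  then show ?thesis
    unfolding potential_step defs by simp
qed

lemma potential_lower: "(1 - \<mu>) * (avg f)\<^sup>2 \<le> potential f"
proof -
  have "2 * (avg f * ip row_mean f) \<le> \<mu> * (avg f)\<^sup>2 + dev_sq f"
  proof (rule two_mult_le_add_of_sq_le_mult)
    show "(avg f * ip row_mean f)\<^sup>2 \<le> \<mu> * (avg f)\<^sup>2 * dev_sq f"
      using mult_left_mono[OF ip_row_mean_sq_le[of f], of "(avg f)\<^sup>2"] by (simp add: power_mult_distrib mult_ac)
  qed (use mu_nonneg dev_sq_nonneg in auto)
  then show ?thesis by (simp add: potential_eq algebra_simps)
qed

lemma potential_nonneg: "0 \<le> potential f"
proof -
  have "0 \<le> (1 - \<mu>) * (avg f)\<^sup>2" using mu_le_half by simp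
  then show ?thesis using potential_lower by (rule order_trans)
qed

text \<open>
  \<open>ip (step f) (step f) - potential f\<close> is \<open>a^2 * \<mu> + 2 * a * y\<close> plus a quadratic form in the
  deviation of \<open>f\<close> from its mean \<open>a\<close>, which is at most \<open>- dev_sq f / 2\<close>. As
  \<open>y = ip row_mean (compress f)\<close> is linear in that deviation, with squared norm \<open>\<nu>\<close>, the form
  absorbs \<open>2 * a * y\<close> at the cost of \<open>2 * a^2 * \<nu>\<close>. Finally \<open>potential_lower\<close> bounds \<open>a^2\<close>.
\<close>

lemma norm_step_le: "ip (step f) (step f) \<le> (1 + 2 * \<mu>) * potential f"
proof -
  define a d y W r where defs: "a = avg f" "d = ip row_mean f" "y = ip row_mean (compress f)"
    "W = ip (compress f) (compress f)" "r = dev_sq f"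
  have d: "d\<^sup>2 \<le> \<mu> * r" and y: "y\<^sup>2 \<le> \<nu> * r" and W: "2 * W \<le> (1 - 2 * \<mu>) * r" and "r \<ge> 0"
    unfolding defs
    by (rule ip_row_mean_sq_le ip_row_mean_compress_sq_le_dev compress_norm_le_dev dev_sq_nonneg)+
  have "2 * (a * y) \<le> 2 * a\<^sup>2 * \<nu> + r / 2"
  proof (rule two_mult_le_add_of_sq_le_mult)
    show "(a * y)\<^sup>2 \<le> 2 * a\<^sup>2 * \<nu> * (r / 2)"
      using mult_left_mono[OF y, of "a\<^sup>2"] by (simp add: power_mult_distrib mult_ac)
  qed (use nu_nonneg \<open>r \<ge> 0\<close> in auto)
  moreover have "a\<^sup>2 * (2 * \<nu>) \<le> a\<^sup>2 * ((1 - 2 * \<mu>) * \<mu>)"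
    using nu_le by (intro mult_left_mono) auto
  moreover have "\<mu> * ((1 - \<mu>) * a\<^sup>2) \<le> \<mu> * potential f"
    using potential_lower mu_nonneg unfolding defs by (intro mult_left_mono) auto
  ultimately have "(a - d)\<^sup>2 + a\<^sup>2 * \<mu> + 2 * a * y + W \<le> (a\<^sup>2 + r - 2 * a * d) + 2 * \<mu> * potential f"
    using d W by (simp add: power2_eq_square algebra_simps)
  then show ?thesis
    unfolding ip_step_step defs by (simp add: potential_eq algebra_simps)
qed

text \<open>
  The left-hand side is the square of the inner product of \<open>step f\<close> with \<open>1 + row_mean\<close>, the
  first iterate. In terms of \<open>a = avg f\<close> and \<open>s = f - a - a * row_mean\<close> the potential is the
  diagonal form \<open>(1 - \<mu>) * a^2 + ip s s\<close> and the inner product is the linear form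
  \<open>a - ip (row_mean + compress row_mean) s\<close>. The constant is the squared norm of this linear
  form with respect to that quadratic form.
\<close>

lemma avg_plus_ip_row_mean_step_le:
  "(avg (step f) + ip row_mean (step f))\<^sup>2 \<le> potential f * (1 / (1 - \<mu>) + \<mu> + \<nu>)"
proof -
  define a where "a = avg f"
  define S where "S = potential f - (1 - \<mu>) * a\<^sup>2"
  define z where "z = ip row_mean f - a * \<mu> - ip row_mean (compress f)"
  define s where "s = (\<lambda>x. f x - a - a * row_mean x)"
  have "z = ip (\<lambda>x. row_mean x + compress row_mean x) s"
    by (simp add: z_def s_def ip_simps avg_row_mean avg_compress ip_compress[of row_mean f] \<mu>_def ip_compress_self
        ip_commute[of "compress row_mean" row_mean])
  moreover have "ip s s = S"
    by (simp add: s_def S_def potential_def a_def ip_simps avg_simps avg_row_mean \<mu>_def ip_commute[of f row_mean]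
        power2_eq_square algebra_simps)
  moreover have "ip (\<lambda>x. row_mean x + compress row_mean x) (\<lambda>x. row_mean x + compress row_mean x) = \<mu> + \<nu>"
    by (simp add: ip_simps \<mu>_def \<nu>_def ip_compress_self ip_commute[of "compress row_mean" row_mean])
  ultimately have z: "z\<^sup>2 \<le> (\<mu> + \<nu>) * S"
    using Cauchy_Schwarz_ip[of "\<lambda>x. row_mean x + compress row_mean x" s] by simp
  have S: "S \<ge> 0" using potential_lower by (simp add: S_def a_def)
  have \<mu>1: "1 - \<mu> > 0" using mu_le_half by simp
  define c where "c = \<mu> + \<nu>"
  have c: "c \<ge> 0" using mu_nonneg nu_nonneg by (simp add: c_def)
  have "- 2 * (a * z) \<le> (1 - \<mu>) * a\<^sup>2 * c + S / (1 - \<mu>)"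
  proof -
    have "2 * (- (a * z)) \<le> (1 - \<mu>) * a\<^sup>2 * c + S / (1 - \<mu>)"
    proof (rule two_mult_le_add_of_sq_le_mult)
      show "(- (a * z))\<^sup>2 \<le> (1 - \<mu>) * a\<^sup>2 * c * (S / (1 - \<mu>))"
        using mult_left_mono[OF z, of "a\<^sup>2"] \<mu>1 by (simp add: power_mult_distrib c_def mult_ac)
    qed (use c S \<mu>1 in auto)
    then show ?thesis by simp
  qed
  then have "(a - z)\<^sup>2 \<le> a\<^sup>2 + (1 - \<mu>) * a\<^sup>2 * c + S / (1 - \<mu>) + c * S"
    using z by (simp add: power2_eq_square algebra_simps c_def)
  also have "\<dots> = ((1 - \<mu>) * a\<^sup>2 + S) * (1 / (1 - \<mu>) + c)"
    using \<mu>1 by (simp add: field_simps)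
  also have "(1 - \<mu>) * a\<^sup>2 + S = potential f" by (simp add: S_def)
  also have "a - z = avg (step f) + ip row_mean (step f)"
    by (simp add: avg_step ip_row_mean_step z_def a_def)
  finally show ?thesis by (simp add: c_def add.assoc)
qed

text \<open>
  In a tournament, \<open>walk k x\<close> is an upper bound for the number of walks of \<open>k\<close> arcs from \<open>x\<close>,
  divided by \<open>(n / 2)^k\<close>.
\<close>

definition walk :: "nat \<Rightarrow> 'v \<Rightarrow> real" where
  "walk k = (step ^^ k) (\<lambda>x. 1)"

lemma walk_Suc: "walk (Suc k) = step (walk k)"
  by (simp add: walk_def)

lemma walk_1: "walk 1 = (\<lambda>x. 1 + row_mean x)"
  by (simp add: walk_def step_def avg_const kernel_op_def row_mean_def)

lemma avg_walk_1: "avg (walk 1) = 1" and ip_row_mean_walk_1: "ip row_mean (walk 1) = \<mu>"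
  and ip_walk_1: "ip (walk 1) (walk 1) = 1 + \<mu>"
  unfolding walk_1 by (simp_all add: ip_simps avg_simps avg_row_mean \<mu>_def)

lemma compress_walk_1: "compress (walk 1) = compress row_mean"
  using compress_diff[of "walk 1" "\<lambda>x. 1"] unfolding walk_1 by (simp add: compress_const)

lemma walk_2: "walk 2 = step (walk 1)"
  by (simp add: numeral_2_eq_2 walk_Suc)

text \<open>
  This iterate is treated directly: the potential of \<open>walk 1\<close> is \<open>1 - \<mu>\<close>, which is too large for
  \<open>norm_step_le\<close> to give a bound by \<open>1\<close>.
\<close>

lemma norm_walk_2: "ip (walk 2) (walk 2) \<le> 1"
proof -
  have "ip (walk 2) (walk 2) = (1 - \<mu>)\<^sup>2 + \<mu> + \<nu>"
    unfolding walk_2 ip_step_step compress_walk_1 avg_walk_1 ip_row_mean_walk_1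
    by (simp add: ip_compress_self \<nu>_def)
  moreover have "\<mu> * \<mu> \<le> \<mu> * (1/2)" using mu_nonneg mu_le_half by (intro mult_left_mono)
  ultimately show ?thesis using nu_le mu_nonneg by (simp add: power2_eq_square algebra_simps)
qed

lemma potential_walk_2: "potential (walk 2) = 1 - 3 * \<mu> + 3 * \<mu>\<^sup>2 + \<nu>"
  unfolding walk_2 potential_step compress_walk_1 avg_walk_1 ip_row_mean_walk_1
  by (simp add: ip_compress_self \<nu>_def potential_def dev_sq_def avg_walk_1 ip_row_mean_walk_1 ip_walk_1
     avg_walk_1[simplified] ip_row_mean_walk_1[simplified] ip_walk_1[simplified]
     power2_eq_square algebra_simps)

lemma potential_walk_le:
  assumes "k \<ge> 2"
  shows "potential (walk k) \<le> 1 - 5 / 2 * \<mu> + 2 * \<mu>\<^sup>2"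
  using assms
proof (induction k rule: dec_induct)
  case base
  show ?case using nu_le by (simp add: potential_walk_2 power2_eq_square algebra_simps)
next
  case (step n)
  then show ?case using potential_step_le[of "walk n"] by (simp add: walk_Suc)
qed

lemma norm_walk_le:
  assumes "k \<ge> 2"
  shows "ip (walk k) (walk k) \<le> 1"
proof (cases "k = 2")
  case True
  then show ?thesis using norm_walk_2 by simp
next
  case False
  then obtain j where j: "k = Suc j" "j \<ge> 2" using assms by (cases k) auto
  have "ip (walk k) (walk k) \<le> (1 + 2 * \<mu>) * potential (walk j)"
    using norm_step_le[of "walk j"] j by (simp add: walk_Suc)
  also have "\<dots> \<le> (1 + 2 * \<mu>) * (1 - 5 / 2 * \<mu> + 2 * \<mu>\<^sup>2)"
    using potential_walk_le[OF j(2)] mu_nonneg by (intro mult_left_mono) auto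
  also have "\<dots> = 1 - \<mu> * (1 / 2 + 3 * \<mu> - 4 * (\<mu> * \<mu>))"
    by (simp add: power2_eq_square algebra_simps)
  also have "\<dots> \<le> 1"
  proof -
    have "\<mu> * \<mu> \<le> \<mu> * (1 / 2)" using mu_nonneg mu_le_half by (intro mult_left_mono)
    then show ?thesis using mu_nonneg by simp
  qed
  finally show ?thesis .
qed

lemma ip_walk_1_walk_le:
  assumes "k \<ge> 2"
  shows "ip (walk 1) (walk k) \<le> 1"
proof (cases "k = 2")
  case True
  have "ip (walk 1) (walk 2) = avg (walk 2) + ip row_mean (walk 2)"
    unfolding walk_1 by (simp add: ip_simps)
  also have "\<dots> = 1"
    unfolding walk_2 avg_step ip_row_mean_step compress_walk_1 avg_walk_1 ip_row_mean_walk_1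
    by (simp add: ip_compress_self)
  finally have "ip (walk 1) (walk 2) = 1" .
  with True show ?thesis by simp
next
  case False
  then obtain j where j: "k = Suc j" "j \<ge> 2" using assms by (cases k) auto
  have "ip (walk 1) (walk k) = avg (walk k) + ip row_mean (walk k)"
    unfolding walk_1 by (simp add: ip_simps)
  moreover have "(avg (walk k) + ip row_mean (walk k))\<^sup>2 \<le> 1\<^sup>2"
  proof -
    have \<mu>1: "1 - \<mu> > 0" using mu_le_half by simp
    have nonneg: "0 \<le> 1 / (1 - \<mu>) + \<mu> + \<nu>" using \<mu>1 mu_nonneg nu_nonneg by simp
    have "(avg (walk k) + ip row_mean (walk k))\<^sup>2 \<le> potential (walk j) * (1 / (1 - \<mu>) + \<mu> + \<nu>)"
      using avg_plus_ip_row_mean_step_le[of "walk j"] j by (simp add: walk_Suc)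
    also have "\<dots> \<le> (1 - 5 / 2 * \<mu> + 2 * \<mu>\<^sup>2) * (1 / (1 - \<mu>) + \<mu> + \<nu>)"
      using potential_walk_le[OF j(2)] nonneg by (intro mult_right_mono)
    \<comment> \<open>by \<open>\<nu> \<le> \<mu>/2 - \<mu>^2\<close>; the resulting product is \<open>1\<close> to first order in \<open>\<mu>\<close>, which is why the second order is computed exactly\<close>
    also have "\<dots> \<le> (1 - 5 / 2 * \<mu> + 2 * \<mu>\<^sup>2) * (1 / (1 - \<mu>) + 3 / 2 * \<mu> - \<mu>\<^sup>2)"
      using nu_le potential_walk_le[of 2] potential_nonneg[of "walk 2"]
      by (intro mult_left_mono) (auto simp: power2_eq_square algebra_simps)
    also have "\<dots> = (1 - \<mu> - \<mu>\<^sup>2 * (17 / 4 - 41 / 4 * \<mu> + 15 / 2 * \<mu>\<^sup>2 - 2 * \<mu> ^ 3)) / (1 - \<mu>)"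
      using \<mu>1 by (simp add: field_simps power2_eq_square power3_eq_cube)
    also have "\<dots> \<le> (1 - \<mu>) / (1 - \<mu>)"
    proof (intro divide_right_mono)
      have "0 \<le> 17 / 4 - 41 / 4 * \<mu> + 15 / 2 * \<mu>\<^sup>2 - 2 * \<mu> ^ 3"
      proof -
        have "\<mu>\<^sup>2 * (2 * \<mu>) \<le> \<mu>\<^sup>2 * 1"
          using mu_le_half by (intro mult_left_mono) auto
        \<comment> \<open>the tangent of the square at \<open>1/2\<close>, where the cubic is smallest on the range of \<open>\<mu>\<close>\<close>
        moreover have "\<mu> \<le> \<mu>\<^sup>2 + 1 / 4"
          using zero_le_power2[of "\<mu> - 1 / 2"] by (simp add: power2_eq_square algebra_simps)
        ultimately show ?thesis
          using mu_le_half by (simp add: power2_eq_square power3_eq_cube mult_ac)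
      qed
      then show "1 - \<mu> - \<mu>\<^sup>2 * (17 / 4 - 41 / 4 * \<mu> + 15 / 2 * \<mu>\<^sup>2 - 2 * \<mu> ^ 3) \<le> 1 - \<mu>"
        by simp
    qed (use \<mu>1 in simp)
    finally show ?thesis using \<mu>1 by simp
  qed
  ultimately show ?thesis using power2_le_imp_le[of _ "1::real"] by force
qed

lemma ip_walk_walk_le:
  assumes "k \<ge> 1" "l \<ge> 1" "k + l \<ge> 3"
  shows "ip (walk k) (walk l) \<le> 1"
proof -
  consider "k = 1" "l \<ge> 2" | "l = 1" "k \<ge> 2" | "k \<ge> 2" "l \<ge> 2"
    using assms by linarith
  then show ?thesis
  proof cases
    case 1
    then show ?thesis using ip_walk_1_walk_le by simp
  next
    case 2
    then show ?thesis using ip_walk_1_walk_le[of k] by (simp add: ip_commute)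
  next
    case 3
    have "2 * ip (walk k) (walk l) \<le> ip (walk k) (walk k) + ip (walk l) (walk l)"
      by (intro two_mult_le_add_of_sq_le_mult Cauchy_Schwarz_ip ip_nonneg)
    then show ?thesis using norm_walk_le[of k] norm_walk_le[of l] 3 by simp
  qed
qed

end

section \<open>Counting walks\<close>

context skew_kernel
begin

text \<open>
  The adjoint of \<open>step\<close>. As the transpose of \<open>K\<close> is \<open>- K\<close>, it is also the operator that belongs to
  the converse relation.
\<close>

definition costep :: "('v \<Rightarrow> real) \<Rightarrow> 'v \<Rightarrow> real" where
  "costep f = (\<lambda>x. avg f + kernel_op (\<lambda>x y. - K x y) f x)"

lemma ip_step_costep: "ip (step f) g = ip f (costep g)"
proof -
  have "costep g = (\<lambda>x. avg g - kernel_op K g x)"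
    by (simp add: costep_def kernel_op_def avg_minus)
  then show ?thesis by (simp add: step_def ip_simps ip_kernel_op mult.commute)
qed

lemma step_apply: "step f x = avg f + kernel_op K f x"
  and costep_apply: "costep f x = avg f + kernel_op (\<lambda>x y. - K x y) f x"
  by (simp_all add: step_def costep_def)

text \<open>
  Reading a two-block path from one end to the other produces \<open>costep^k (step^l 1)\<close>, averaged;
  splitting it at the turning vertex produces an inner product.
\<close>

lemma ip_walk_eq_avg: "ip (walk k) g = avg ((costep ^^ k) g)"
proof (induction k arbitrary: g)
  case 0
  then show ?case by (simp add: walk_def ip_simps)
next
  case (Suc k)
  then show ?case
    by (simp add: walk_Suc ip_step_costep funpow_swap1)
qed

end

text \<open>
  Walks in \<open>V\<close> from \<open>v\<close> whose \<open>i\<close>-th step is taken along the \<open>i\<close>-th relation of the list; a mixture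
  of a relation and its converse encodes an orientation pattern.
\<close>

primrec walks_along :: "'v set \<Rightarrow> 'v rel list \<Rightarrow> 'v \<Rightarrow> 'v list set" where
  "walks_along V [] v = {[v]}"
| "walks_along V (R # Rs) v = (\<Union>w\<in>{w \<in> V. (v, w) \<in> R}. Cons v ` walks_along V Rs w)"

lemma mem_walks_along:
  assumes "length xs = Suc (length Rs)" "set xs \<subseteq> V"
    and "\<And>i. i < length Rs \<Longrightarrow> (xs ! i, xs ! Suc i) \<in> Rs ! i"
  shows "xs \<in> walks_along V Rs (hd xs)"
  using assms
proof (induction Rs arbitrary: xs)
  case Nil
  then show ?case by (cases xs) auto
next
  case (Cons R Rs)
  then obtain x ys where xs: "xs = x # ys" by (cases xs) auto
  have ys: "length ys = Suc (length Rs)" "set ys \<subseteq> V" using Cons.prems xs by auto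
  have "(ys ! i, ys ! Suc i) \<in> Rs ! i" if "i < length Rs" for i
    using Cons.prems(3)[of "Suc i"] that by (simp add: xs)
  then have "ys \<in> walks_along V Rs (hd ys)" by (intro Cons.IH ys)
  moreover have "(x, hd ys) \<in> R"
    using Cons.prems(3)[of 0] ys by (cases ys) (auto simp: xs)
  moreover have "hd ys \<in> V" using ys by (cases ys) auto
  ultimately show ?case by (auto simp: xs)
qed

lemma finite_walks_along: "finite V \<Longrightarrow> finite (walks_along V Rs v)"
  by (induction Rs arbitrary: v) auto

context finite_average
begin

text \<open>
  Why the skew operators enter: the indicator of a relation without opposite arcs is at most
  \<open>(1 + k v w) / 2\<close> for the difference \<open>k\<close> between it and its converse, and averaging
  a function against \<open>1 + k v w\<close> is applying \<open>step\<close> or \<open>costep\<close>.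
\<close>
lemma card_walks_along_Cons_le:
  fixes k :: "'v \<Rightarrow> 'v \<Rightarrow> real"
  assumes bound: "\<And>w. w \<in> V \<Longrightarrow> real (card (walks_along V Rs w)) \<le> c * f w"
    and k: "\<And>w. w \<in> V \<Longrightarrow> of_bool ((v, w) \<in> R) \<le> (1 + k v w) / 2"
  shows "real (card (walks_along V (R # Rs) v)) \<le> real (card V) / 2 * c * (avg f + kernel_op k f v)"
proof -
  have "real (card (walks_along V (R # Rs) v))
      \<le> real (\<Sum>w\<in>{w \<in> V. (v, w) \<in> R}. card (Cons v ` walks_along V Rs w))"
    unfolding walks_along.simps of_nat_le_iff by (rule card_UN_le) (simp add: finite_V)
  also have "\<dots> = (\<Sum>w\<in>{w \<in> V. (v, w) \<in> R}. real (card (walks_along V Rs w)))"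
    by (simp add: card_image)
  also have "\<dots> = (\<Sum>w\<in>V. of_bool ((v, w) \<in> R) * real (card (walks_along V Rs w)))"
    using finite_V by (simp add: sum.inter_filter of_bool_def if_distrib[of "\<lambda>b. b * _"] cong: if_cong)
  also have "\<dots> \<le> (\<Sum>w\<in>V. (1 + k v w) / 2 * (c * f w))"
  proof (rule sum_mono)
    fix w assume w: "w \<in> V"
    have "0 \<le> (1 + k v w) / 2" using k[OF w] by (rule order_trans[rotated]) simp
    then show "of_bool ((v, w) \<in> R) * real (card (walks_along V Rs w)) \<le> (1 + k v w) / 2 * (c * f w)"
      using k[OF w] bound[OF w] by (intro mult_mono) auto
  qed
  also have "\<dots> = (\<Sum>w\<in>V. c / 2 * (f w + k v w * f w))"
    by (intro sum.cong) (auto simp: algebra_simps)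
  also have "\<dots> = real (card V) * avg (\<lambda>w. c / 2 * (f w + k v w * f w))"
    using card_V_pos by (simp add: avg_def)
  also have "\<dots> = real (card V) / 2 * c * (avg f + kernel_op k f v)"
    unfolding avg_mult_left avg_add kernel_op_def by simp
  finally show ?thesis .
qed

end

locale oriented_relation = finite_average V for V :: "'v set" +
  fixes E :: "'v rel"
  assumes asym: "(x, y) \<in> E \<Longrightarrow> (y, x) \<notin> E"
begin

sublocale skew_kernel V "\<lambda>x y. of_bool ((x, y) \<in> E) - of_bool ((y, x) \<in> E)"
  by unfold_locales (auto simp: of_bool_def)

lemma card_walks_along_le_walk:
  "v \<in> V \<Longrightarrow> real (card (walks_along V (replicate l E) v)) \<le> (real (card V) / 2) ^ l * walk l v"
proof (induction l arbitrary: v)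
  case 0
  then show ?case by (simp add: walk_def)
next
  case (Suc l)
  have "real (card (walks_along V (E # replicate l E) v)) \<le>
      real (card V) / 2 * (real (card V) / 2) ^ l * step (walk l) v"
    by (simp only: step_apply, rule card_walks_along_Cons_le[OF Suc.IH])
      (auto simp: of_bool_def asym)
  then show ?case by (simp add: walk_Suc)
qed

lemma card_walks_along_le_costep_walk:
  "v \<in> V \<Longrightarrow> real (card (walks_along V (replicate k (E\<inverse>) @ replicate l E) v))
    \<le> (real (card V) / 2) ^ (k + l) * (costep ^^ k) (walk l) v"
proof (induction k arbitrary: v)
  case 0
  then show ?case using card_walks_along_le_walk by simp
next
  case (Suc k)
  have "real (card (walks_along V (E\<inverse> # (replicate k (E\<inverse>) @ replicate l E)) v)) \<le>
      real (card V) / 2 * (real (card V) / 2) ^ (k + l) * costep ((costep ^^ k) (walk l)) v"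
    by (simp only: costep_apply, rule card_walks_along_Cons_le[OF Suc.IH])
      (auto simp: of_bool_def asym)
  then show ?case by simp
qed

lemma sum_card_walks_along_le:
  assumes "k \<ge> 1" "l \<ge> 1" "k + l \<ge> 3"
  shows "(\<Sum>v\<in>V. real (card (walks_along V (replicate k (E\<inverse>) @ replicate l E) v)))
    \<le> real (card V) * (real (card V) / 2) ^ (k + l)"
proof -
  let ?n = "real (card V)"
  have "(\<Sum>v\<in>V. real (card (walks_along V (replicate k (E\<inverse>) @ replicate l E) v)))
      \<le> (\<Sum>v\<in>V. (?n / 2) ^ (k + l) * (costep ^^ k) (walk l) v)"
    by (intro sum_mono card_walks_along_le_costep_walk)
  also have "\<dots> = ?n * (?n / 2) ^ (k + l) * avg ((costep ^^ k) (walk l))"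
    using card_V_pos by (simp add: avg_def sum_distrib_left[symmetric])
  also have "\<dots> = ?n * (?n / 2) ^ (k + l) * ip (walk k) (walk l)"
    by (simp add: ip_walk_eq_avg)
  also have "\<dots> \<le> ?n * (?n / 2) ^ (k + l) * 1"
    using ip_walk_walk_le[OF assms] by (intro mult_left_mono) auto
  finally show ?thesis by simp
qed

text \<open>
  A homomorphism is determined by its values along \<open>p\<close>, which form a walk that runs \<open>k\<close> times
  against \<open>E\<close> and then \<open>l\<close> times along it.
\<close>

lemma card_homs_two_blocks_le:
  assumes H: "distinct p" "pverts H = set p" "length p = Suc (k + l)" and T: "pverts T = V"
    and first: "\<And>f i. f \<in> homs H T \<Longrightarrow> i < k \<Longrightarrow> (f (p ! Suc i), f (p ! i)) \<in> E"
    and second: "\<And>f i. f \<in> homs H T \<Longrightarrow> k \<le> i \<Longrightarrow> i < k + l \<Longrightarrow> (f (p ! i), f (p ! Suc i)) \<in> E"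
    and kl: "k \<ge> 1" "l \<ge> 1" "k + l \<ge> 3"
  shows "real (card (homs H T)) \<le> real (card V) * (real (card V) / 2) ^ (k + l)"
proof -
  let ?Rs = "replicate k (E\<inverse>) @ replicate l E"
  have "inj_on (\<lambda>f. map f p) (homs H T)"
  proof (rule inj_onI)
    fix f g assume "f \<in> homs H T" "g \<in> homs H T" "map f p = map g p"
    then show "f = g"
      using H(2) by (intro PiE_ext[of f "pverts H" "\<lambda>_. pverts T" g]) (auto simp: homs_def)
  qed
  moreover have "(\<lambda>f. map f p) ` homs H T \<subseteq> (\<Union>v\<in>V. walks_along V ?Rs v)"
  proof (rule image_subsetI)
    fix f assume f: "f \<in> homs H T"
    have sub: "set (map f p) \<subseteq> V" using f H(2) T by (auto simp: homs_def)
    have "map f p \<in> walks_along V ?Rs (hd (map f p))"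
    proof (rule mem_walks_along[OF _ sub])
      show "(map f p ! i, map f p ! Suc i) \<in> ?Rs ! i" if "i < length ?Rs" for i
        using that first[OF f, of i] second[OF f, of i] H(3) by (auto simp: nth_append)
    qed (simp add: H(3))
    moreover have "hd (map f p) \<in> V" using sub H(3) by (cases p) auto
    ultimately show "map f p \<in> (\<Union>v\<in>V. walks_along V ?Rs v)" by blast
  qed
  moreover have "finite (\<Union>v\<in>V. walks_along V ?Rs v)"
    using finite_V by (auto intro: finite_walks_along)
  ultimately have "card (homs H T) \<le> card (\<Union>v\<in>V. walks_along V ?Rs v)"
    by (rule card_inj_on_le)
  also have "\<dots> \<le> (\<Sum>v\<in>V. card (walks_along V ?Rs v))"
    using finite_V by (rule card_UN_le)
  finally have "real (card (homs H T)) \<le> real (\<Sum>v\<in>V. card (walks_along V ?Rs v))"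
    by (rule of_nat_mono)
  also have "\<dots> \<le> real (card V) * (real (card V) / 2) ^ (k + l)"
    using sum_card_walks_along_le[OF kl] by simp
  finally show ?thesis .
qed

end

section \<open>Blocks of an oriented path\<close>

lemma injective_unit_walk_monotone:
  fixes f :: "nat \<Rightarrow> int"
  assumes inj: "inj_on f {..<N}"
    and unit: "\<And>j. Suc j < N \<Longrightarrow> \<bar>f (Suc j) - f j\<bar> = 1"
  shows "(\<forall>j<N. f j = f 0 + int j) \<or> (\<forall>j<N. f j = f 0 - int j)"
proof (cases "N \<le> 1")
  case True
  then show ?thesis by (cases N) auto
next
  case False
  define c where "c = f 1 - f 0"
  have c: "\<bar>c\<bar> = 1" using unit[of 0] False by (simp add: c_def)
  have step: "f (Suc j) - f j = c" if "Suc j < N" for j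
    using that
  proof (induction j)
    case 0
    then show ?case by (simp add: c_def)
  next
    case (Suc j)
    have "f (Suc (Suc j)) \<noteq> f j"
      using inj_onD[OF inj, of "Suc (Suc j)" j] Suc.prems by auto
    then show ?case using unit[OF Suc.prems] Suc c by linarith
  qed
  have "f j = f 0 + c * int j" if "j < N" for j
    using that
  proof (induction j)
    case (Suc j)
    then show ?case using step[of j] by (simp add: algebra_simps)
  qed simp
  then have "\<forall>j<N. f j = f 0 + c * int j" by blast
  moreover have "c = 1 \<or> c = - 1" using c by linarith
  ultimately show ?thesis by (metis diff_conv_add_uminus mult_1 mult_minus1)
qed

lemma path_order_rev:
  assumes "path_order p H"
  shows "path_order (rev p) H"
proof -
  have "(\<exists>i. Suc i < length p \<and> {u, v} = {p ! i, p ! Suc i})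
      \<longleftrightarrow> (\<exists>i. Suc i < length p \<and> {u, v} = {rev p ! i, rev p ! Suc i})" (is "?L \<longleftrightarrow> ?R") for u v
  proof
    assume ?L
    then obtain i where i: "Suc i < length p" "{u, v} = {p ! i, p ! Suc i}" by blast
    then have "{u, v} = {rev p ! (length p - 2 - i), rev p ! Suc (length p - 2 - i)}"
      by (auto simp: rev_nth numeral_2_eq_2 Suc_diff_Suc)
    then show ?R using i(1) by (intro exI[of _ "length p - 2 - i"]) auto
  next
    assume ?R
    then obtain i where i: "Suc i < length p" "{u, v} = {rev p ! i, rev p ! Suc i}" by blast
    then have "{u, v} = {p ! (length p - 2 - i), p ! Suc (length p - 2 - i)}"
      by (auto simp: rev_nth numeral_2_eq_2 Suc_diff_Suc)
    then show ?L using i(1) by (intro exI[of _ "length p - 2 - i"]) auto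
  qed
  with assms show ?thesis by (simp add: path_order_def)
qed

lemma subgraph_with_proj_iff:
  "subgraph (with_proj B) (with_proj H) \<longleftrightarrow>
    pverts B \<subseteq> pverts H \<and> parcs B \<subseteq> parcs H \<and> pair_wf_digraph B \<and> pair_wf_digraph H"
  by (auto simp: subgraph_def compatible_def wf_digraph_wp_iff)

lemma path_order_edge:
  assumes "path_order p H" "Suc i < length p"
  shows "(p ! i, p ! Suc i) \<in> parcs H \<or> (p ! Suc i, p ! i) \<in> parcs H"
  using assms unfolding path_order_def by blast

text \<open>
  Neighbours in \<open>q\<close> are neighbours in \<open>p\<close>, so the positions in \<open>p\<close> of the vertices of \<open>q\<close> move by
  one at each step. As they do not repeat, they move in one direction only.
\<close>

lemma subpath_consecutive:
  assumes p: "path_order p H" and q: "path_order q B"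
    and sub: "subgraph (with_proj B) (with_proj H)"
  shows "\<exists>s. s + length q \<le> length p \<and>
    ((\<forall>j<length q. q ! j = p ! (s + j)) \<or> (\<forall>j<length q. rev q ! j = p ! (s + j)))"
proof -
  have dist: "distinct p" "distinct q" and "q \<noteq> []" and sets: "set p = pverts H" "set q = pverts B"
    using p q by (auto simp: path_order_def)
  have "set q \<subseteq> set p" using sub sets by (simp add: subgraph_with_proj_iff)
  then have "\<forall>j<length q. \<exists>i<length p. p ! i = q ! j"
    by (meson in_set_conv_nth nth_mem subsetD)
  then obtain f where f: "\<And>j. j < length q \<Longrightarrow> f j < length p \<and> p ! f j = q ! j"
    by metis
  have unit: "f (Suc j) = Suc (f j) \<or> f j = Suc (f (Suc j))" if j: "Suc j < length q" for j
  proof -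
    have "(q ! j, q ! Suc j) \<in> parcs H \<or> (q ! Suc j, q ! j) \<in> parcs H"
      using path_order_edge[OF q j] sub by (auto simp: subgraph_with_proj_iff)
    then obtain i where i: "Suc i < length p" "{q ! j, q ! Suc j} = {p ! i, p ! Suc i}"
      using p unfolding path_order_def by blast
    then have "{p ! f j, p ! f (Suc j)} = {p ! i, p ! Suc i}" using f j by simp
    then have "f j = i \<and> f (Suc j) = Suc i \<or> f j = Suc i \<and> f (Suc j) = i"
      using i(1) f[of j] f[of "Suc j"] j dist(1) by (auto simp: doubleton_eq_iff nth_eq_iff_index_eq)
    then show ?thesis by auto
  qed
  have "inj_on (\<lambda>j. int (f j)) {..<length q}"
  proof (rule inj_onI)
    fix i j assume "i \<in> {..<length q}" "j \<in> {..<length q}" "int (f i) = int (f j)"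
    then have "q ! i = q ! j" "i < length q" "j < length q" using f[of i] f[of j] by auto
    then show "i = j" using dist(2) nth_eq_iff_index_eq by blast
  qed
  moreover have "\<bar>int (f (Suc j)) - int (f j)\<bar> = 1" if "Suc j < length q" for j
    using unit[OF that] by auto
  ultimately consider "\<forall>j<length q. int (f j) = int (f 0) + int j"
    | "\<forall>j<length q. int (f j) = int (f 0) - int j"
    using injective_unit_walk_monotone by blast
  then show ?thesis
  proof cases
    case 1
    then have eq: "f j = f 0 + j" if "j < length q" for j using that by (metis of_nat_add of_nat_eq_iff)
    have "f 0 + length q \<le> length p"
      using f[of "length q - 1"] eq[of "length q - 1"] \<open>q \<noteq> []\<close> by (cases "length q") auto
    moreover have "\<forall>j<length q. q ! j = p ! (f 0 + j)" using f eq by metis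
    ultimately show ?thesis by blast
  next
    case 2
    define s where "s = f (length q - 1)"
    have f0: "f 0 = s + (length q - 1)"
      using 2 \<open>q \<noteq> []\<close> unfolding s_def by (cases "length q") force+
    have "rev q ! j = p ! (s + j)" if j: "j < length q" for j
    proof -
      have lt: "length q - Suc j < length q" using j by simp
      have "f (length q - Suc j) = s + j"
        using 2[rule_format, OF lt] f0 j by linarith
      then show ?thesis using f[OF lt] j by (simp add: rev_nth)
    qed
    then have "\<forall>j<length q. rev q ! j = p ! (s + j)" by blast
    moreover have "s + length q \<le> length p"
      using f[of 0] f0 \<open>q \<noteq> []\<close> by (cases "length q") auto
    ultimately show ?thesis by blast
  qed
qed

text \<open>
  The last clause of \<open>unidirectional_path_def\<close>, isolated because it is invariant under reversal.
\<close>

definition one_way :: "'a list \<Rightarrow> 'a pair_pre_digraph \<Rightarrow> bool" where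
  "one_way q B \<longleftrightarrow> (\<forall>i. Suc i < length q \<longrightarrow> (q ! i, q ! Suc i) \<in> parcs B) \<or>
     (\<forall>i. Suc i < length q \<longrightarrow> (q ! Suc i, q ! i) \<in> parcs B)"

lemma one_way_rev:
  assumes "one_way q B"
  shows "one_way (rev q) B"
proof -
  have *: "rev q ! i = q ! Suc (length q - 2 - i) \<and> rev q ! Suc i = q ! (length q - 2 - i)
      \<and> Suc (length q - 2 - i) < length q" if "Suc i < length q" for i
    using that by (auto simp: rev_nth numeral_2_eq_2 Suc_diff_Suc)
  show ?thesis
    using assms * unfolding one_way_def length_rev by metis
qed

text \<open>
  A subpath that contains two edges of \<open>p\<close> contains every edge between them. The vertex order of
  \<open>B\<close> may be assumed to run in the same sense as \<open>p\<close>; then the arcs of \<open>B\<close>, all of which point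
  forwards or all of which point backwards, do so in \<open>p\<close> as well.
\<close>

lemma unidirectional_subpath_direction:
  assumes H: "oriented_graph H" and p: "path_order p H"
    and sub: "subgraph (with_proj B) (with_proj H)" and uni: "unidirectional_path B"
    and i: "Suc i < length p" "(p ! i, p ! Suc i) \<in> parcs B \<or> (p ! Suc i, p ! i) \<in> parcs B"
    and k: "Suc k < length p" "(p ! k, p ! Suc k) \<in> parcs B \<or> (p ! Suc k, p ! k) \<in> parcs B"
    and j: "i \<le> j" "j \<le> k"
  shows "(p ! j, p ! Suc j) \<in> parcs H \<longleftrightarrow> (p ! i, p ! Suc i) \<in> parcs H"
proof -
  obtain q0 where q0: "path_order q0 B" "one_way q0 B"
    using uni unfolding unidirectional_path_def one_way_def by blast
  obtain q s where q: "path_order q B" "one_way q B" and s: "s + length q \<le> length p"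
    "\<And>j. j < length q \<Longrightarrow> q ! j = p ! (s + j)"
    using subpath_consecutive[OF p q0(1) sub] q0 path_order_rev one_way_rev length_rev by metis
  have dist: "distinct p" using p by (simp add: path_order_def)
  have range: "s \<le> e \<and> Suc e < s + length q"
    if e: "Suc e < length p" "(p ! e, p ! Suc e) \<in> parcs B \<or> (p ! Suc e, p ! e) \<in> parcs B" for e
  proof -
    obtain l where l: "Suc l < length q" "{p ! e, p ! Suc e} = {q ! l, q ! Suc l}"
      using e(2) q(1) unfolding path_order_def by blast
    then have "{p ! e, p ! Suc e} = {p ! (s + l), p ! Suc (s + l)}" using s(2) by simp
    then have "e = s + l"
      using dist e(1) l(1) s(1) by (auto simp: doubleton_eq_iff nth_eq_iff_index_eq)
    then show ?thesis using l by simp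
  qed
  have q_eq: "q ! (e - s) = p ! e \<and> q ! Suc (e - s) = p ! Suc e \<and> Suc (e - s) < length q"
    if "i \<le> e" "e \<le> k" for e
    using range[OF i] range[OF k] that s(2)[of "e - s"] s(2)[of "Suc (e - s)"] by auto
  have sub': "parcs B \<subseteq> parcs H" using sub by (simp add: subgraph_with_proj_iff)
  have "(\<forall>e. i \<le> e \<longrightarrow> e \<le> k \<longrightarrow> (p ! e, p ! Suc e) \<in> parcs H) \<or>
      (\<forall>e. i \<le> e \<longrightarrow> e \<le> k \<longrightarrow> (p ! Suc e, p ! e) \<in> parcs H)"
  proof -
    have "(p ! e, p ! Suc e) \<in> parcs H"
      if "\<forall>l. Suc l < length q \<longrightarrow> (q ! l, q ! Suc l) \<in> parcs B" "i \<le> e" "e \<le> k" for e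
      using that(1)[rule_format, of "e - s"] q_eq[OF that(2,3)] sub' by auto
    moreover have "(p ! Suc e, p ! e) \<in> parcs H"
      if "\<forall>l. Suc l < length q \<longrightarrow> (q ! Suc l, q ! l) \<in> parcs B" "i \<le> e" "e \<le> k" for e
      using that(1)[rule_format, of "e - s"] q_eq[OF that(2,3)] sub' by auto
    ultimately show ?thesis using q(2) unfolding one_way_def by blast
  qed
  then show ?thesis
    using j oriented_graph.asymmetric[OF H] by (meson order_refl order_trans)
qed

lemma oriented_graph_subgraph:
  assumes H: "oriented_graph H" and sub: "subgraph (with_proj B) (with_proj H)"
  shows "oriented_graph B"
proof -
  interpret oriented_graph H by fact
  have B: "pverts B \<subseteq> pverts H" "parcs B \<subseteq> parcs H" "pair_wf_digraph B"
    using sub by (simp_all add: subgraph_with_proj_iff)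
  interpret B: pair_wf_digraph B by fact
  show ?thesis
  proof unfold_locales
    show "finite (pverts B)" using B(1) finite_verts by (auto intro: finite_subset)
    show "finite (parcs B)" using B(2) finite_arcs by (auto intro: finite_subset)
    show "fst e \<noteq> snd e" if "e \<in> parcs B" for e
      using B(2) that no_loops' by (cases e) auto
    show "(v, u) \<notin> parcs B" if "(u, v) \<in> parcs B" for u v
      using B(2) that asymmetric by blast
  qed
qed

lemma single_edge_unidirectional:
  assumes H: "oriented_graph H" and p: "path_order p H" and i: "Suc i < length p"
  shows "\<exists>B. subgraph (with_proj B) (with_proj H) \<and> unidirectional_path B \<and>
    ((p ! i, p ! Suc i) \<in> parcs B \<or> (p ! Suc i, p ! i) \<in> parcs B)"
proof -
  interpret oriented_graph H by fact
  define B where "B = \<lparr>pverts = {p ! i, p ! Suc i},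
    parcs = parcs H \<inter> {(p ! i, p ! Suc i), (p ! Suc i, p ! i)}\<rparr>"
  have "p ! i \<in> pverts H" "p ! Suc i \<in> pverts H"
    using p i by (auto simp: path_order_def)
  then have sub: "subgraph (with_proj B) (with_proj H)"
    by (auto simp: subgraph_with_proj_iff B_def pair_wf_digraph_def pair_wf_digraph_axioms)
  have edge: "(p ! i, p ! Suc i) \<in> parcs B \<or> (p ! Suc i, p ! i) \<in> parcs B"
    using path_order_edge[OF p i] by (auto simp: B_def)
  have "p ! i \<noteq> p ! Suc i" using p i by (auto simp: path_order_def nth_eq_iff_index_eq)
  then have "path_order [p ! i, p ! Suc i] B"
    using edge by (auto simp: path_order_def B_def doubleton_eq_iff)
  then have "unidirectional_path B"
    unfolding unidirectional_path_def using oriented_graph_subgraph[OF H sub] edge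
    by (intro conjI exI[of _ "[p ! i, p ! Suc i]"]) auto
  with sub edge show ?thesis by blast
qed

text \<open>
  Among the finitely many candidates, one with the largest number of vertices and arcs is maximal
  for the subgraph relation.
\<close>

lemma unidirectional_subpath_in_block:
  assumes H: "oriented_graph H"
    and B: "subgraph (with_proj B) (with_proj H)" "unidirectional_path B"
  shows "\<exists>C \<in> blocks H. subgraph (with_proj B) (with_proj C)"
proof -
  interpret oriented_graph H by fact
  define cand where "cand C \<longleftrightarrow> subgraph (with_proj C) (with_proj H) \<and> unidirectional_path C \<and>
    subgraph (with_proj B) (with_proj C)" for C
  define msr where "msr C = card (pverts C) + card (parcs C)" for C :: "'a pair_pre_digraph"
  have "cand B"
    using B by (auto simp: cand_def subgraph_with_proj_iff)
  moreover have "\<forall>C. cand C \<longrightarrow> msr C \<le> msr H"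
    by (auto simp: cand_def msr_def subgraph_with_proj_iff intro!: add_mono card_mono)
  ultimately obtain C where C: "cand C" and max: "\<And>C'. cand C' \<Longrightarrow> msr C' \<le> msr C"
    using ex_has_greatest_nat[of cand B msr "Suc (msr H)"] by (metis le_imp_less_Suc)
  have "C' = C" if C': "subgraph (with_proj C') (with_proj H)" "unidirectional_path C'"
    "subgraph (with_proj C) (with_proj C')" for C'
  proof -
    have "cand C'" using C C' subgraph_trans unfolding cand_def by blast
    then have le: "msr C' \<le> msr C" by (rule max)
    have fin: "finite (pverts C')" "finite (parcs C')"
      using C'(1) by (auto simp: subgraph_with_proj_iff intro: finite_subset)
    have sub: "pverts C \<subseteq> pverts C'" "parcs C \<subseteq> parcs C'"
      using C'(3) by (auto simp: subgraph_with_proj_iff)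
    have "card (pverts C) \<le> card (pverts C')" "card (parcs C) \<le> card (parcs C')"
      using fin sub by (auto intro: card_mono)
    with le have "card (pverts C) = card (pverts C')" "card (parcs C) = card (parcs C')"
      by (auto simp: msr_def)
    then have "pverts C = pverts C'" "parcs C = parcs C'"
      using fin sub by (auto simp: card_subset_eq)
    then show ?thesis by simp
  qed
  then show ?thesis using C unfolding cand_def blocks_def by blast
qed

text \<open>
  Without a change of direction, \<open>H\<close> itself is unidirectional and is the only block. With more
  than one change there are edges \<open>i < j < k\<close> of alternating directions. No block contains two of them:
  by \<open>unidirectional_subpath_direction\<close> it would have a constant direction from one to the other,
  and a block through \<open>i\<close> and \<open>k\<close> also contains \<open>j\<close>. So there are three blocks.
\<close>

lemma two_blocks_turning_point:
  assumes H: "oriented_graph H" and p: "path_order p H" and two: "card (blocks H) = 2"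
  obtains k where "0 < k" "Suc k < length p"
    "\<And>i. i < k \<Longrightarrow> (p ! i, p ! Suc i) \<in> parcs H \<longleftrightarrow> (p ! 0, p ! 1) \<in> parcs H"
    "\<And>i. k \<le> i \<Longrightarrow> Suc i < length p \<Longrightarrow> (p ! i, p ! Suc i) \<in> parcs H \<longleftrightarrow> (p ! 0, p ! 1) \<notin> parcs H"
proof -
  define dir where "dir i \<longleftrightarrow> (p ! i, p ! Suc i) \<in> parcs H" for i
  define touches where "touches C i \<longleftrightarrow> (p ! i, p ! Suc i) \<in> parcs C \<or> (p ! Suc i, p ! i) \<in> parcs C"
    for C :: "'a pair_pre_digraph" and i
  have block: "\<exists>C \<in> blocks H. touches C i" if i: "Suc i < length p" for i
  proof -
    obtain B where "subgraph (with_proj B) (with_proj H)" "unidirectional_path B" "touches B i"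
      using single_edge_unidirectional[OF H p i] unfolding touches_def by blast
    moreover from this obtain C where "C \<in> blocks H" "subgraph (with_proj B) (with_proj C)"
      using unidirectional_subpath_in_block[OF H] by blast
    ultimately show ?thesis
      unfolding touches_def subgraph_with_proj_iff by blast
  qed
  have const: "dir j \<longleftrightarrow> dir i"
    if "C \<in> blocks H" "touches C i" "touches C k" "i \<le> j" "j \<le> k" "Suc k < length p" for C i j k
    unfolding dir_def
    by (rule unidirectional_subpath_direction[OF H p, of C _ k])
      (use that in \<open>auto simp: blocks_def touches_def\<close>)
  have no_zigzag: False
    if "i < j" "j < k" "Suc k < length p" "dir i \<noteq> dir j" "dir j \<noteq> dir k" for i j k
  proof -
    have "Suc i < length p" "Suc j < length p" "Suc k < length p" using that by auto
    then obtain Ci Cj Ck where blocks: "Ci \<in> blocks H" "touches Ci i" "Cj \<in> blocks H" "touches Cj j"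
      "Ck \<in> blocks H" "touches Ck k"
      using block[of i] block[of j] block[of k] by blast
    have "Ci \<noteq> Cj" "Cj \<noteq> Ck" "Ci \<noteq> Ck"
      using const[of Ci i j j] const[of Cj j k k] const[of Ci i k j] blocks that by auto
    then have "card {Ci, Cj, Ck} = 3" by simp
    moreover have "finite (blocks H)" using two by (auto intro: card_ge_0_finite)
    ultimately show False
      using card_mono[of "blocks H" "{Ci, Cj, Ck}"] blocks two by simp
  qed
  have "\<exists>i. Suc i < length p \<and> dir i \<noteq> dir 0"
  proof (rule ccontr)
    assume "\<not> ?thesis"
    then have same: "dir i = dir 0" if "Suc i < length p" for i using that by blast
    have "unidirectional_path H"
      unfolding unidirectional_path_def
    proof (intro conjI exI[of _ p])
      show "(\<forall>i. Suc i < length p \<longrightarrow> (p ! i, p ! Suc i) \<in> parcs H) \<or>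
        (\<forall>i. Suc i < length p \<longrightarrow> (p ! Suc i, p ! i) \<in> parcs H)"
        using same path_order_edge[OF p] unfolding dir_def by metis
    qed (use H p in auto)
    moreover have "subgraph (with_proj H) (with_proj H)"
      using H by (simp add: subgraph_with_proj_iff oriented_graph_def pair_digraph_def pair_fin_digraph_def)
    ultimately have "blocks H \<subseteq> {H}" unfolding blocks_def by blast
    then show False using two card_mono[of "{H}" "blocks H"] by simp
  qed
  then obtain k where k: "Suc k < length p" "dir k \<noteq> dir 0"
    and min: "\<And>i. i < k \<Longrightarrow> \<not> (Suc i < length p \<and> dir i \<noteq> dir 0)"
    using exists_least_iff[of "\<lambda>i. Suc i < length p \<and> dir i \<noteq> dir 0"] by blast
  have least: "dir i = dir 0" if "i < k" for i
    using min[OF that] k(1) that by auto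
  have pos: "0 < k" using k by (cases k) auto
  have turned: "dir i = (\<not> dir 0)" if "k \<le> i" "Suc i < length p" for i
  proof (cases "i = k")
    case True
    then show ?thesis using k(2) by blast
  next
    case False
    then show ?thesis using no_zigzag[of 0 k i] k(2) pos that by (metis le_neq_implies_less)
  qed
  show ?thesis
  proof (rule that[of k])
    show "0 < k" "Suc k < length p" by (fact pos k(1))+
    show "(p ! i, p ! Suc i) \<in> parcs H \<longleftrightarrow> (p ! 0, p ! 1) \<in> parcs H" if "i < k" for i
      using least[OF that] by (simp only: dir_def One_nat_def)
    show "(p ! i, p ! Suc i) \<in> parcs H \<longleftrightarrow> (p ! 0, p ! 1) \<notin> parcs H"
      if "k \<le> i" "Suc i < length p" for i
      using turned[OF that] by (simp only: dir_def One_nat_def)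
  qed
qed

lemma card_parcs_path:
  assumes H: "oriented_graph H" and p: "path_order p H"
  shows "card (parcs H) = length p - 1"
proof -
  define arc where "arc i = (if (p ! i, p ! Suc i) \<in> parcs H then (p ! i, p ! Suc i)
      else (p ! Suc i, p ! i))" for i
  have dist: "distinct p" using p by (simp add: path_order_def)
  have "parcs H = arc ` {..<length p - 1}"
  proof (intro set_eqI iffI)
    fix e assume e: "e \<in> parcs H"
    obtain u v where uv: "e = (u, v)" by (cases e)
    then obtain i where "Suc i < length p" "{u, v} = {p ! i, p ! Suc i}"
      using p e unfolding path_order_def by blast
    then show "e \<in> arc ` {..<length p - 1}"
      using oriented_graph.asymmetric[OF H, of u v] e uv
      by (intro image_eqI[of _ _ i]) (auto simp: arc_def doubleton_eq_iff)
  next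
    fix e assume "e \<in> arc ` {..<length p - 1}"
    then obtain i where "i < length p - 1" "e = arc i" by blast
    then show "e \<in> parcs H"
      using path_order_edge[OF p, of i] by (auto simp: arc_def less_diff_conv)
  qed
  moreover have "inj_on arc {..<length p - 1}"
  proof (rule inj_onI)
    fix i j assume "i \<in> {..<length p - 1}" "j \<in> {..<length p - 1}" "arc i = arc j"
    then show "i = j"
      using dist by (auto simp: arc_def nth_eq_iff_index_eq split: if_splits)
  qed
  ultimately show ?thesis by (simp add: card_image)
qed

section \<open>Paths with two blocks\<close>

theorem theorem1p4:
  fixes H :: "'a pair_pre_digraph"
  assumes "oriented_path H" and "card (blocks H) = 2" and "card (parcs H) \<ge> 3"
  shows "tournament_anti_sidorenko TYPE('b) H"
  unfolding tournament_anti_sidorenko_def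
proof (intro allI impI)
  fix T :: "'b pair_pre_digraph"
  assume "tournament T"
  then interpret T: tournament T .
  obtain p where H: "oriented_graph H" and p: "path_order p H"
    using assms(1) unfolding oriented_path_def by blast
  have H_verts: "distinct p" "pverts H = set p" "p \<noteq> []" using p by (auto simp: path_order_def)
  obtain k where k: "0 < k" "Suc k < length p"
    and first: "\<And>i. i < k \<Longrightarrow> (p ! i, p ! Suc i) \<in> parcs H \<longleftrightarrow> (p ! 0, p ! 1) \<in> parcs H"
    and second: "\<And>i. k \<le> i \<Longrightarrow> Suc i < length p \<Longrightarrow>
        (p ! i, p ! Suc i) \<in> parcs H \<longleftrightarrow> (p ! 0, p ! 1) \<notin> parcs H"
    using two_blocks_turning_point[OF H p assms(2)] by blast
  define l where "l = length p - Suc k"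
  have len: "length p = Suc (k + l)" and kl: "k \<ge> 1" "l \<ge> 1" using k by (auto simp: l_def)
  have arcs: "card (parcs H) = k + l" using card_parcs_path[OF H p] len by simp
  have verts: "card (pverts H) = Suc (k + l)" using H_verts len by (simp add: distinct_card)
  have edge: "(p ! i, p ! Suc i) \<in> parcs H \<or> (p ! Suc i, p ! i) \<in> parcs H" if "i < k + l" for i
    using path_order_edge[OF p] that len by simp
  have hom: "(f u, f v) \<in> parcs T" if "f \<in> homs H T" "(u, v) \<in> parcs H" for f u v
    using that by (auto simp: homs_def)
  let ?n = "real (card (pverts T))"
  have "real (card (homs H T)) \<le> ?n * (?n / 2) ^ (k + l)"
  proof (cases "pverts T = {}")
    case True
    then have "(pverts H \<rightarrow>\<^sub>E pverts T) = {}" using H_verts by (auto simp: PiE_eq_empty_iff neq_Nil_conv)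
    \<comment> \<open>hence the density is \<open>0 / 0 = 0\<close>\<close>
    then have "homs H T = {}" unfolding homs_def by blast
    then show ?thesis by simp
  next
    case nonempty: False
    \<comment> \<open>\<open>E\<close> is chosen such that the images of both blocks lead away from the turning vertex; if the blocks lead towards it in \<open>H\<close>, this is the converse of the tournament\<close>
    define E where "E = (if (p ! 0, p ! 1) \<in> parcs H then (parcs T)\<inverse> else parcs T)"
    interpret oriented_relation "pverts T" E
      using nonempty by unfold_locales (auto simp: E_def T.asymmetric split: if_splits)
    show ?thesis
    proof (rule card_homs_two_blocks_le[OF H_verts(1,2) len refl])
      fix f i assume f: "f \<in> homs H T"
      show "(f (p ! Suc i), f (p ! i)) \<in> E" if "i < k"
        using first[OF that] edge[of i] that hom[OF f] by (auto simp: E_def)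
      show "(f (p ! i), f (p ! Suc i)) \<in> E" if "k \<le> i" "i < k + l"
        using second[OF that(1)] edge[OF that(2)] that len hom[OF f] by (auto simp: E_def)
    qed (use kl arcs assms(3) in auto)
  qed
  then have "hom_density H T \<le> ?n * (?n / 2) ^ (k + l) / ?n ^ Suc (k + l)"
    unfolding hom_density_def verts by (rule divide_right_mono) simp
  also have "\<dots> \<le> (1 / 2) ^ card (parcs H)"
    by (cases "?n = 0") (simp_all add: arcs power_divide)
  finally show "hom_density H T \<le> (1 / 2) ^ card (parcs H)" .
qed

end
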